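(* Let $H$ be an even $3$--hypergraph. Then $\omega(H)\geq \omega(\mathrm{link}_H(v))+1$ for every $v\in V(H)$.
   Context: A $3$--hypergraph $H$ has a finite vertex set $V(H)$ and edge set $E(H)\subseteq\binom{V(H)}{3}$; $\omega(H)$ is the largest size of a subset of $V(H)$ all of whose $3$-element subsets are edges. $H$ is even if every $4$-element subset of $V(H)$ contains an even number of edges of $H$. For $v\in V(H)$, $\mathrm{link}_H(v)$ is the simple graph with vertex set $\{w\neq v : \{v,w\}\subset e \text{ for some } e\in E(H)\}$ and edge set $\{\{u,w\}: \{v,u,w\}\in E(H)\}$; $\omega$ of a graph is its usual clique number. *)

theory Defs
  imports Main
begin

record 'a hypergraph =
  vertices :: "'a set"
  hyperedges :: "'a set set"

definition uniform_hypergraph :: "nat \<Rightarrow> 'a hypergraph \<Rightarrow> bool" where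
  "uniform_hypergraph r H \<longleftrightarrow>
     finite (vertices H) \<and> hyperedges H \<subseteq> {e. e \<subseteq> vertices H \<and> card e = r}"

abbreviation three_hypergraph :: "'a hypergraph \<Rightarrow> bool" where
  "three_hypergraph \<equiv> uniform_hypergraph 3"

abbreviation simple_graph :: "'a hypergraph \<Rightarrow> bool" where
  "simple_graph \<equiv> uniform_hypergraph 2"

definition even_hypergraph :: "'a hypergraph \<Rightarrow> bool" where
  "even_hypergraph H \<longleftrightarrow>
     (\<forall>S. S \<subseteq> vertices H \<and> card S = 4 \<longrightarrow> even (card {e \<in> hyperedges H. e \<subseteq> S}))"

text \<open>Sets with fewer than three vertices satisfy the condition vacuously.\<close>

definition hypergraph_omega :: "'a hypergraph \<Rightarrow> nat" where
  "hypergraph_omega H =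
     Max {card S | S. S \<subseteq> vertices H \<and> (\<forall>T. T \<subseteq> S \<and> card T = 3 \<longrightarrow> T \<in> hyperedges H)}"

definition graph_omega :: "'a hypergraph \<Rightarrow> nat" where
  "graph_omega G =
     Max {card S | S. S \<subseteq> vertices G \<and> (\<forall>u\<in>S. \<forall>w\<in>S. u \<noteq> w \<longrightarrow> {u, w} \<in> hyperedges G)}"

definition link :: "'a hypergraph \<Rightarrow> 'a \<Rightarrow> 'a hypergraph" where
  "link H v =
     \<lparr>vertices = {w. w \<noteq> v \<and> (\<exists>e\<in>hyperedges H. {v, w} \<subseteq> e)},
      hyperedges = {{u, w} | u w. {v, u, w} \<in> hyperedges H}\<rparr>"

lemma simple_graph_link:
  assumes "three_hypergraph H"
  shows "simple_graph (link H v)"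
proof -
  have fin: "finite (vertices H)"
    and E: "\<And>e. e \<in> hyperedges H \<Longrightarrow> e \<subseteq> vertices H \<and> card e = 3"
    using assms by (auto simp: uniform_hypergraph_def)
  have "vertices (link H v) \<subseteq> vertices H"
    using E by (auto simp: link_def)
  then have "finite (vertices (link H v))"
    using fin finite_subset by blast
  moreover have "e \<subseteq> vertices (link H v) \<and> card e = 2" if edge: "e \<in> hyperedges (link H v)" for e
  proof -
    obtain u w where e: "e = {u, w}" and vuw: "{v, u, w} \<in> hyperedges H"
      using edge by (auto simp: link_def)
    have "card {v, u, w} = 3" using E[OF vuw] by simp
    then have "v \<noteq> u" "v \<noteq> w" "u \<noteq> w"
      by (auto simp: card_insert_if split: if_splits)
    then show ?thesis using vuw by (auto simp: e link_def)
  qed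
  ultimately show ?thesis by (auto simp: uniform_hypergraph_def)
qed

end

theory Submission imports Defs begin

lemma insert_link_edge_iff: "{a, b} \<in> hyperedges (link H v) \<longleftrightarrow> {v, a, b} \<in> hyperedges H"
proof
  assume "{a, b} \<in> hyperedges (link H v)"
  then obtain u w where "{a, b} = {u, w}" "{v, u, w} \<in> hyperedges H"
    by (auto simp: link_def)
  then show "{v, a, b} \<in> hyperedges H" by metis
qed (auto simp: link_def)

lemma vertices_link_subset:
  assumes "three_hypergraph H"
  shows "vertices (link H v) \<subseteq> vertices H"
  using assms by (auto simp: link_def uniform_hypergraph_def)

text \<open>If all triples of the 4-set \<open>insert v T\<close> through \<open>v\<close> are edges, there are three of them,
  so evenness forces the remaining triple \<open>T\<close> to be an edge as well.\<close>

lemma even_hypergraph_triple_edge: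
  assumes H: "three_hypergraph H" "even_hypergraph H"
    and T: "T \<subseteq> vertices H" "card T = 3" and v: "v \<in> vertices H" "v \<notin> T"
    and through: "\<And>x. x \<in> T \<Longrightarrow> insert v (T - {x}) \<in> hyperedges H"
  shows "T \<in> hyperedges H"
proof (rule ccontr)
  assume nT: "T \<notin> hyperedges H"
  have fin: "finite T" using T(2) by (metis card.infinite zero_neq_numeral)
  let ?X = "insert v T"
  have cX: "card ?X = 4" using T(2) v(2) fin by simp
  \<comment> \<open>Every triple in the 4-set \<open>?X\<close> omits exactly one vertex. The triple
    omitting \<open>v\<close> is \<open>T\<close>, a non-edge by \<open>nT\<close>; the triples
    omitting some \<open>x\<close> in \<open>T\<close> are edges by \<open>through\<close>. This
    bijection with \<open>T\<close> counts the edges.\<close>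
  have "{e \<in> hyperedges H. e \<subseteq> ?X} = (\<lambda>x. insert v (T - {x})) ` T" (is "?L = ?R")
  proof
    show "?L \<subseteq> ?R"
    proof
      fix e assume "e \<in> ?L"
      then have e: "e \<in> hyperedges H" "e \<subseteq> ?X" by auto
      then have ce: "card e = 3" using H(1) by (auto simp: uniform_hypergraph_def)
      have "card (?X - e) = 1"
        using e(2) ce cX fin by (subst card_Diff_subset) (auto intro: finite_subset)
      then obtain x where x: "?X - e = {x}" by (auto simp: card_1_singleton_iff)
      then have ex: "e = ?X - {x}" "x \<in> ?X" using e(2) by auto
      \<comment> \<open>If the omitted vertex were \<open>v\<close>, then \<open>e\<close> would be
        \<open>T\<close>, contradicting \<open>nT\<close>.\<close>
      then have "x \<noteq> v" using e(1) nT v(2) by auto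
      then show "e \<in> ?R" using ex by auto
    qed
    show "?R \<subseteq> ?L" using through by auto
  qed
  moreover have "inj_on (\<lambda>x. insert v (T - {x})) T"
  proof (rule inj_onI)
    fix x y assume xy: "x \<in> T" "y \<in> T" and eq: "insert v (T - {x}) = insert v (T - {y})"
    \<comment> \<open>Among the elements of \<open>T\<close>, only \<open>x\<close> is missing from
      its image, so the image determines \<open>x\<close>.\<close>
    have "x \<notin> insert v (T - {x})" using xy(1) v(2) by auto
    then have "x \<notin> insert v (T - {y})" by (simp only: eq not_False_eq_True)
    then show "x = y" using xy(1) by auto
  qed
  ultimately have "card ?L = 3" using T(2) by (simp add: card_image)
  moreover have "even (card ?L)"
    using H(2) cX T(1) v(1) unfolding even_hypergraph_def by blast
  ultimately show False by simp
qed

text \<open>Adding \<open>v\<close> to a clique of its link gives a clique of \<open>H\<close>. A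
  triple containing \<open>v\<close> is \<open>v\<close> plus an edge of the link. A triple
  \<open>T\<close> avoiding \<open>v\<close> lies in \<open>S\<close>, so each of its pairs forms an
  edge with \<open>v\<close>, and evenness on \<open>insert v T\<close> yields \<open>T\<close>
  itself.\<close>

lemma link_clique_insert:
  assumes H: "three_hypergraph H" "even_hypergraph H" and v: "v \<in> vertices H"
    and S: "S \<subseteq> vertices (link H v)"
    and clique: "\<And>u w. u \<in> S \<Longrightarrow> w \<in> S \<Longrightarrow> u \<noteq> w \<Longrightarrow> {u, w} \<in> hyperedges (link H v)"
    and T: "T \<subseteq> insert v S" "card T = 3"
  shows "T \<in> hyperedges H"
proof -
  have pair: "insert v P \<in> hyperedges H" if P: "P \<subseteq> S" "card P = 2" for P
  proof -
    obtain a b where "P = {a, b}" "a \<noteq> b" using P(2) by (auto simp: card_2_iff)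
    then show ?thesis using clique[of a b] P(1) by (simp add: insert_link_edge_iff)
  qed
  have fin: "finite T" using T(2) by (metis card.infinite zero_neq_numeral)
  show ?thesis
  proof (cases "v \<in> T")
    case True
    then show ?thesis using pair[of "T - {v}"] T fin by (auto simp: insert_absorb)
  next
    case False
    then have TS: "T \<subseteq> S" using T(1) by blast
    show ?thesis
    proof (rule even_hypergraph_triple_edge[OF H _ T(2) v False])
      show "T \<subseteq> vertices H" using TS S vertices_link_subset[OF H(1)] by blast
      show "insert v (T - {x}) \<in> hyperedges H" if "x \<in> T" for x
        using pair[of "T - {x}"] TS T(2) fin that by auto
    qed
  qed
qed

theorem lemma2:
  fixes H :: "'a hypergraph"
  assumes "three_hypergraph H" and "even_hypergraph H"
  shows "\<forall>v\<in>vertices H. hypergraph_omega H \<ge> graph_omega (link H v) + 1"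
proof
  fix v assume v: "v \<in> vertices H"
  let ?G = "link H v"
  let ?C = "{card S | S. S \<subseteq> vertices ?G \<and> (\<forall>u\<in>S. \<forall>w\<in>S. u \<noteq> w \<longrightarrow> {u, w} \<in> hyperedges ?G)}"
  let ?D = "{card S | S. S \<subseteq> vertices H \<and> (\<forall>T. T \<subseteq> S \<and> card T = 3 \<longrightarrow> T \<in> hyperedges H)}"
  have finH: "finite (vertices H)" using assms(1) by (simp add: uniform_hypergraph_def)
  have sub: "vertices ?G \<subseteq> vertices H" by (rule vertices_link_subset[OF assms(1)])
  have finG: "finite (vertices ?G)" using sub finH by (rule finite_subset)
  have "finite ?C" by (rule finite_subset[of _ "card ` Pow (vertices ?G)"]) (auto simp: finG)
  \<comment> \<open>The empty clique makes \<open>?C\<close> nonempty, so the maximum is attained by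
    an actual clique \<open>S\<close>, even when the link has no vertices.\<close>
  moreover have "card {} \<in> ?C" by (intro CollectI exI[of _ "{}"]) simp
  ultimately have "Max ?C \<in> ?C" by (intro Max_in) (assumption, rule ex_in_conv[THEN iffD1, OF exI])
  then obtain S where S: "Max ?C = card S" "S \<subseteq> vertices ?G"
    and clique: "\<And>u w. u \<in> S \<Longrightarrow> w \<in> S \<Longrightarrow> u \<noteq> w \<Longrightarrow> {u, w} \<in> hyperedges ?G"
    by blast
  \<comment> \<open>The link excludes \<open>v\<close> from its own vertices; this is the source of
    the \<open>+ 1\<close>.\<close>
  have "v \<notin> S" using S(2) by (auto simp: link_def)
  then have card: "card (insert v S) = card S + 1"
    using S(2) finG by (simp add: finite_subset)
  \<comment> \<open>That \<open>v\<close> is a vertex comes from the hypothesis, not from the link: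
    \<open>v\<close> may lie in no edge, in which case \<open>S\<close> is empty and the clique is
    \<open>{v}\<close>.\<close>
  have "insert v S \<subseteq> vertices H" using v S(2) sub by blast
  moreover have "\<forall>T. T \<subseteq> insert v S \<and> card T = 3 \<longrightarrow> T \<in> hyperedges H"
    using link_clique_insert[OF assms v S(2) clique] by blast
  ultimately have "card S + 1 \<in> ?D"
    by (intro CollectI exI[of _ "insert v S"]) (simp add: card)
  \<comment> \<open>Finiteness is what makes \<open>Max ?D\<close> an upper bound for the size of
    the extended clique.\<close>
  moreover have "finite ?D"
    by (rule finite_subset[of _ "card ` Pow (vertices H)"]) (auto simp: finH)
  ultimately have "card S + 1 \<le> Max ?D" by (rule Max_ge[rotated])
  then show "hypergraph_omega H \<ge> graph_omega ?G + 1"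
    unfolding hypergraph_omega_def graph_omega_def S(1) .
qed

end
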